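(* Let $\mathcal{T}$ be a finite set of Wang tiles. If there exist $r\in\mathbb{N}$ and $i\in\{1,2\}$ such that the output of the procedure FindMarkers$(\mathcal{T},i,r)$ (described in the context) contains a set $M$, then $M\subset\mathcal{T}$ is a subset of markers in the direction $\mathbf e_i$.
   Context: A Wang tile is a unit square with colored edges (right, top, left, bottom). The Wang shift $\Omega_{\mathcal T}$ is the set of all $x:\mathbb{Z}^2\to\mathcal{T}$ such that for every $\mathbf n$ the right color of $x(\mathbf n)$ equals the left color of $x(\mathbf n+\mathbf e_1)$ and the top color of $x(\mathbf n)$ equals the bottom color of $x(\mathbf n+\mathbf e_2)$. A nonempty $M\subset\mathcal{T}$ is a subset of markers in the direction $\mathbf e_1$ if for every $w\in\Omega_{\mathcal T}$ there is $A\subset\mathbb{Z}$ with $w^{-1}(M)=A\times\mathbb{Z}$ and $1\notin A-A$; in the direction $\mathbf e_2$ if for every $w\in\Omega_{\mathcal T}$ there is $B\subset\mathbb{Z}$ with $w^{-1}(M)=\mathbb{Z}\times B$ and $1\notin B-B$. The domino $u\odot^jv$ is the pattern with $u$ at some position $\mathbf n$ and $v$ at $\mathbf n+\mathbf e_j$. A rectangular pattern $u$ of shape $\mathbf n$ over $\mathcal{T}$ admits a surrounding of radius $r$ if there is a rectangular pattern of shape $\mathbf n+2(r,r)$ over $\mathcal{T}$ in which all pairs of horizontally or vertically adjacent tiles have matching edge colors and in which $u$ occurs at position $(r,r)$ (i.e. in the center). Procedure FindMarkers$(\mathcal{T},i,r)$: let $j=3-i$. Let $D_j$ be the set of $(u,v)\in\mathcal{T}^2$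 such that the domino $u\odot^jv$ admits a surrounding of radius $r$ with tiles in $\mathcal{T}$. Start with the partition $U$ of $\mathcal{T}$ into singletons and, for every $(u,v)\in D_j$, merge the classes of $U$ containing $u$ and $v$. Let $D_i$ be the set of $(u,v)\in\mathcal{T}^2$ such that $u\odot^iv$ admits a surrounding of radius $r$ with tiles in $\mathcal{T}$. Return the collection of all classes $M$ of the final partition $U$ such that $(M\times M)\cap D_i=\varnothing$. *)

theory Defs
  imports "HOL-Library.Product_Plus"
begin

datatype 'c wang_tile =
  Wang_Tile (right_color: 'c) (top_color: 'c) (left_color: 'c) (bottom_color: 'c)

definition unit_vec :: "nat \<Rightarrow> 'a::zero_neq_one \<times> 'a" where
  "unit_vec i = (if i = 1 then (1, 0) else (0, 1))"

definition wang_shift :: "'c wang_tile set \<Rightarrow> (int \<times> int \<Rightarrow> 'c wang_tile) set" where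
  "wang_shift T = {x. range x \<subseteq> T \<and>
     (\<forall>n. right_color (x n) = left_color (x (n + unit_vec 1)) \<and>
          top_color (x n) = bottom_color (x (n + unit_vec 2)))}"

text \<open>The difference set \<open>A - A\<close> is written out as a set comprehension,
  since the operator \<open>-\<close> on sets denotes the relative complement.\<close>

definition is_markers :: "'c wang_tile set \<Rightarrow> nat \<Rightarrow> 'c wang_tile set \<Rightarrow> bool" where
  "is_markers T i M \<longleftrightarrow> M \<noteq> {} \<and> M \<subseteq> T \<and>
     (i = 1 \<and> (\<forall>w \<in> wang_shift T. \<exists>A :: int set.
         w -` M = A \<times> UNIV \<and> 1 \<notin> {a - b | a b. a \<in> A \<and> b \<in> A}) \<or>
      i = 2 \<and> (\<forall>w \<in> wang_shift T. \<exists>B :: int set.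
         w -` M = UNIV \<times> B \<and> 1 \<notin> {a - b | a b. a \<in> B \<and> b \<in> B}))"

text \<open>A rectangular pattern of shape \<open>n\<close> is a total function on \<open>nat \<times> nat\<close>
  of which only the values on \<open>rectangle n\<close> are relevant.\<close>

definition rectangle :: "nat \<times> nat \<Rightarrow> (nat \<times> nat) set" where
  "rectangle n = {..<fst n} \<times> {..<snd n}"

definition matching_pattern :: "nat \<times> nat \<Rightarrow> (nat \<times> nat \<Rightarrow> 'c wang_tile) \<Rightarrow> bool" where
  "matching_pattern n p \<longleftrightarrow>
     (\<forall>k. k \<in> rectangle n \<and> k + unit_vec 1 \<in> rectangle n \<longrightarrow>
        right_color (p k) = left_color (p (k + unit_vec 1))) \<and>
     (\<forall>k. k \<in> rectangle n \<and> k + unit_vec 2 \<in> rectangle n \<longrightarrow>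
        top_color (p k) = bottom_color (p (k + unit_vec 2)))"

definition admits_surrounding ::
  "'c wang_tile set \<Rightarrow> nat \<Rightarrow> nat \<times> nat \<Rightarrow> (nat \<times> nat \<Rightarrow> 'c wang_tile) \<Rightarrow> bool" where
  "admits_surrounding T r n u \<longleftrightarrow>
     (\<exists>p. p ` rectangle (n + (2 * r, 2 * r)) \<subseteq> T \<and>
          matching_pattern (n + (2 * r, 2 * r)) p \<and>
          (\<forall>k \<in> rectangle n. p (k + (r, r)) = u k))"

text \<open>The domino with \<open>u\<close> at the origin and \<open>v\<close> next to it in direction \<open>j\<close>
  has shape \<open>(1, 1) + unit_vec j\<close>.\<close>

definition domino :: "'c wang_tile \<Rightarrow> 'c wang_tile \<Rightarrow> nat \<times> nat \<Rightarrow> 'c wang_tile" where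
  "domino u v = (\<lambda>k. if k = (0, 0) then u else v)"

definition surrounded_dominoes ::
  "'c wang_tile set \<Rightarrow> nat \<Rightarrow> nat \<Rightarrow> ('c wang_tile \<times> 'c wang_tile) set" where
  "surrounded_dominoes T j r =
     {(u, v). u \<in> T \<and> v \<in> T \<and> admits_surrounding T r ((1, 1) + unit_vec j) (domino u v)}"

definition merge_classes :: "'a \<times> 'a \<Rightarrow> 'a set set \<Rightarrow> 'a set set" where
  "merge_classes d U =
     insert (\<Union>{C \<in> U. fst d \<in> C \<or> snd d \<in> C}) {C \<in> U. fst d \<notin> C \<and> snd d \<notin> C}"

text \<open>Merge steps commute, so the fold over the finite set of dominoes below
  does not depend on the order in which the dominoes are processed.\<close>

lemma comp_fun_commute_merge_classes: "comp_fun_commute merge_classes"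
proof -
  have "merge_classes e (merge_classes d U) = merge_classes d (merge_classes e U)"
    for d e :: "'a \<times> 'a" and U
  proof -
    define t where "t d C \<longleftrightarrow> fst d \<in> C \<or> snd d \<in> C" for d :: "'a \<times> 'a" and C
    have merge: "merge_classes d U = insert (\<Union>{C \<in> U. t d C}) {C \<in> U. \<not> t d C}" for d U
      by (simp add: merge_classes_def t_def)
    have t_Union: "t d (\<Union>V) \<longleftrightarrow> (\<exists>C \<in> V. t d C)" for d V
      by (auto simp: t_def)
    have twice: "merge_classes e (merge_classes d U) =
      (if \<exists>C \<in> U. t d C \<and> t e C
       then insert (\<Union>{C \<in> U. t d C \<or> t e C}) {C \<in> U. \<not> t d C \<and> \<not> t e C}
       else {\<Union>{C \<in> U. t d C}, \<Union>{C \<in> U. t e C}} \<union> {C \<in> U. \<not> t d C \<and> \<not> t e C})"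
      for d e
    proof (cases "\<exists>C \<in> U. t d C \<and> t e C")
      case True
      then have "t e (\<Union>{C \<in> U. t d C})"
        by (auto simp: t_Union)
      then have "{C \<in> merge_classes d U. t e C} =
            insert (\<Union>{C \<in> U. t d C}) {C \<in> U. \<not> t d C \<and> t e C}"
          "{C \<in> merge_classes d U. \<not> t e C} = {C \<in> U. \<not> t d C \<and> \<not> t e C}"
        by (auto simp: merge)
      moreover have "\<Union>(insert (\<Union>{C \<in> U. t d C}) {C \<in> U. \<not> t d C \<and> t e C}) =
          \<Union>{C \<in> U. t d C \<or> t e C}"
        by auto
      ultimately show ?thesis
        using True by (simp add: merge[of e])
    next
      case False
      then have "\<not> t e (\<Union>{C \<in> U. t d C})"
        by (auto simp: t_Union)
      then have "{C \<in> merge_classes d U. t e C} = {C \<in> U. t e C}"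
          "{C \<in> merge_classes d U. \<not> t e C} =
            insert (\<Union>{C \<in> U. t d C}) {C \<in> U. \<not> t d C \<and> \<not> t e C}"
        using False by (auto simp: merge)
      then show ?thesis
        unfolding if_not_P[OF False] by (simp add: merge[of e] insert_commute)
    qed
    show ?thesis
      unfolding twice[of e d] twice[of d e]
      by (simp only: conj_commute disj_commute insert_commute)
  qed
  then show ?thesis
    by unfold_locales (simp add: fun_eq_iff)
qed

definition find_markers ::
  "'c wang_tile set \<Rightarrow> nat \<Rightarrow> nat \<Rightarrow> 'c wang_tile set set" where
  "find_markers T i r =
     (let j = 3 - i;
          U = Finite_Set.fold merge_classes ((\<lambda>t. {t}) ` T) (surrounded_dominoes T j r)
      in {M \<in> U. (M \<times> M) \<inter> surrounded_dominoes T i r = {}})"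

end

theory Submission
  imports Defs "HOL-Library.Disjoint_Sets"
begin

text \<open>Every domino \<open>(w n, w (n + unit_vec j))\<close> occurring in a point \<open>w\<close> of the Wang shift
  has surroundings of every radius, cut out of \<open>w\<close> itself. Hence for \<open>j = 3 - i\<close> both of its
  tiles lie in the same class, so membership in \<open>M\<close> is invariant under translation by
  \<open>unit_vec j\<close>, while for \<open>j = i\<close> they cannot both lie in \<open>M\<close>.\<close>

text \<open>The inserted union is nonempty since some class contains \<open>fst d\<close>; if
  \<open>d\<close> met no class, the empty set would be inserted. Disjointness survives because the
  merged classes are exactly those that are removed.\<close>

lemma partition_on_merge_classes:
  assumes "partition_on T U" and "fst d \<in> T"
  shows "partition_on T (merge_classes d U)"
proof (rule partition_onI)
  show "\<Union>(merge_classes d U) = T"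
    using partition_onD1[OF assms(1)] by (auto simp: merge_classes_def)
  obtain C where "C \<in> U" "fst d \<in> C"
    using partition_onD1[OF assms(1)] assms(2) by auto
  then have "\<Union>{C \<in> U. fst d \<in> C \<or> snd d \<in> C} \<noteq> {}"
    by auto
  then show "{} \<notin> merge_classes d U"
    using partition_onD3[OF assms(1)] unfolding merge_classes_def by blast
  show "disjnt p q" if "p \<in> merge_classes d U" "q \<in> merge_classes d U" "p \<noteq> q" for p q
    using that disjointD[OF partition_onD2[OF assms(1)]]
    unfolding merge_classes_def disjnt_def by blast
qed

text \<open>Induction on \<open>D\<close>: the new merge puts both tiles of \<open>d\<close> into
  one class, and earlier pairs stay together because every class after a merge is a union of classes
  before it.\<close>

lemma fold_merge_classes:
  assumes "finite D" and "D \<subseteq> T \<times> T" and "partition_on T U"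
  defines "V \<equiv> Finite_Set.fold merge_classes U D"
  shows "partition_on T V \<and> (\<forall>(u, v) \<in> D. \<forall>C \<in> V. u \<in> C \<longleftrightarrow> v \<in> C)"
  using assms(1,2) unfolding V_def
proof (induction D rule: finite_induct)
  case empty
  then show ?case
    using assms(3) by simp
next
  case (insert d D)
  let ?V = "Finite_Set.fold merge_classes U D"
  \<comment> \<open>As merge steps commute, \<open>d\<close> may be taken to be processed
    last.\<close>
  have fold: "Finite_Set.fold merge_classes U (insert d D) = merge_classes d ?V"
    using insert.hyps comp_fun_commute_on.fold_insert[OF comp_fun_commute_merge_classes[unfolded comp_fun_commute_def']]
    by blast
  have part: "partition_on T ?V" and iff: "\<forall>(u, v) \<in> D. \<forall>C \<in> ?V. u \<in> C \<longleftrightarrow> v \<in> C"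
    using insert.IH insert.prems by blast+
  have d: "fst d \<in> T" "snd d \<in> T"
    using insert.prems by auto
  have "u \<in> C \<longleftrightarrow> v \<in> C" if "(u, v) \<in> insert d D" "C \<in> merge_classes d ?V" for u v C
  proof (cases "(u, v) = d")
    case True
    \<comment> \<open>Both tiles are covered by classes of \<open>?V\<close>, so the merged class
      contains both; the classes left over contain neither.\<close>
    have "fst d \<in> \<Union>?V" "snd d \<in> \<Union>?V"
      using partition_onD1[OF part] d by auto
    then show ?thesis
      using True that(2) unfolding merge_classes_def by auto
  next
    case False
    then show ?thesis
      using that iff unfolding merge_classes_def by blast
  qed
  then show ?case
    unfolding fold using partition_on_merge_classes[OF part d(1)] by blast
qed

lemma surrounded_dominoes_wang_shift:
  assumes w: "w \<in> wang_shift T" and j: "j \<in> {1, 2}"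
  shows "(w n, w (n + unit_vec j)) \<in> surrounded_dominoes T j r"
proof -
  \<comment> \<open>A window of \<open>w\<close> whose cell \<open>(r, r)\<close> lies over
    \<open>n\<close>; the subtraction takes place in \<open>int\<close>, since it would be truncated
    in \<open>nat\<close>.\<close>
  define p where
    "p k = w (n + (int (fst k) - int r, int (snd k) - int r))" for k :: "nat \<times> nat"
  have range: "w m \<in> T"
    and horizontal: "right_color (w m) = left_color (w (m + (1, 0)))"
    and vertical: "top_color (w m) = bottom_color (w (m + (0, 1)))" for m
    using w by (auto simp: wang_shift_def unit_vec_def simp del: split_paired_All)
  have "p (k + (1, 0)) = w (n + (int (fst k) - int r, int (snd k) - int r) + (1, 0))"
    "p (k + (0, 1)) = w (n + (int (fst k) - int r, int (snd k) - int r) + (0, 1))" for k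
    by (auto simp: p_def plus_prod_def algebra_simps intro!: arg_cong[where f = w])
  then have "matching_pattern s p" for s
    using horizontal vertical by (simp add: matching_pattern_def unit_vec_def p_def)
  moreover have "p (k + (r, r)) = domino (w n) (w (n + unit_vec j)) k"
    if "k \<in> rectangle ((1, 1) + unit_vec j)" for k
  proof -
    have "k = (0, 0) \<or> k = unit_vec j"
      using that j by (cases k) (auto simp: rectangle_def unit_vec_def)
    then show ?thesis
      using j by (cases n) (auto simp: p_def domino_def unit_vec_def)
  qed
  moreover have "p ` R \<subseteq> T" for R
    using range unfolding p_def by blast
  ultimately have "admits_surrounding T r ((1, 1) + unit_vec j) (domino (w n) (w (n + unit_vec j)))"
    unfolding admits_surrounding_def by blast
  then show ?thesis
    using range unfolding surrounded_dominoes_def by blast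
qed

lemma int_shift_invariant:
  fixes P :: "int \<Rightarrow> bool"
  assumes "\<And>a. P (a + 1) \<longleftrightarrow> P a"
  shows "P a \<longleftrightarrow> P 0"
proof (induction a rule: int_induct[where k = 0])
  \<comment> \<open>Going down from \<open>a\<close> to \<open>a - 1\<close>, the hypothesis is read
    at \<open>a - 1\<close>.\<close>
  case (step2 a)
  then show ?case
    using assms[of "a - 1"] by simp
qed (use assms in auto)

theorem lemma15:
  fixes T :: "'c wang_tile set" and i r :: nat and M :: "'c wang_tile set"
  assumes "finite T"
    and "i \<in> {1, 2}"
    and "M \<in> find_markers T i r"
  shows "is_markers T i M"
proof -
  define j where "j = 3 - i"
  define D where "D = surrounded_dominoes T j r"
  define U where "U = Finite_Set.fold merge_classes ((\<lambda>t. {t}) ` T) D"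
  have M: "M \<in> U" "(M \<times> M) \<inter> surrounded_dominoes T i r = {}"
    using assms(3) by (auto simp: find_markers_def Let_def U_def D_def j_def)
  have D: "D \<subseteq> T \<times> T"
    by (auto simp: D_def surrounded_dominoes_def)
  have "partition_on T ((\<lambda>t. {t}) ` T)"
    by (auto simp: partition_on_def disjoint_def)
  \<comment> \<open>\<open>D\<close> is finite as a subset of \<open>T \<times> T\<close>; on an
    infinite set the fold would just return its starting value.\<close>
  then have part: "partition_on T U" and same: "\<forall>(u, v) \<in> D. \<forall>C \<in> U. u \<in> C \<longleftrightarrow> v \<in> C"
    using fold_merge_classes[OF finite_subset[OF D] D] assms(1) by (auto simp: U_def)
  have "M \<noteq> {}" "M \<subseteq> T"
    using M(1) partition_onD1[OF part] partition_onD3[OF part] by auto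
  have j: "j \<in> {1, 2}"
    using assms(2) by (auto simp: j_def)
  have shift: "w (n + unit_vec j) \<in> M \<longleftrightarrow> w n \<in> M" if "w \<in> wang_shift T" for w n
    using same M(1) surrounded_dominoes_wang_shift[OF that j] unfolding D_def by blast
  have apart: "\<not> (w n \<in> M \<and> w (n + unit_vec i) \<in> M)" if "w \<in> wang_shift T" for w n
    using M(2) surrounded_dominoes_wang_shift[OF that assms(2)] by blast
  consider "i = 1" "j = 2" | "i = 2" "j = 1"
    using assms(2) by (auto simp: j_def)
  then show ?thesis
  proof cases
    case 1
    have "\<exists>A. w -` M = A \<times> UNIV \<and> 1 \<notin> {a - b | a b. a \<in> A \<and> b \<in> A}"
      if w: "w \<in> wang_shift T" for w
    proof (intro exI conjI)
      have "w (a, b) \<in> M \<longleftrightarrow> w (a, 0) \<in> M" for a b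
        using shift[OF w, of "(a, _)"] 1
        by (intro int_shift_invariant[where P = "\<lambda>b. w (a, b) \<in> M"]) (simp add: unit_vec_def)
      \<comment> \<open>The witness for \<open>A\<close> is the trace of the preimage on the
        horizontal axis, as membership is constant along columns.\<close>
      then show "w -` M = {a. w (a, 0) \<in> M} \<times> UNIV"
        by auto
      \<comment> \<open>A difference 1 would put the adjacent cells \<open>(b, 0)\<close> and
        \<open>(b + 1, 0)\<close> into the preimage, against \<open>apart\<close>.\<close>
      show "1 \<notin> {a - b | a b. a \<in> {a. w (a, 0) \<in> M} \<and> b \<in> {a. w (a, 0) \<in> M}}"
        using apart[OF w, of "(_, 0)"] 1 by (auto simp: unit_vec_def eq_diff_eq add.commute)
    qed
    then show ?thesis
      using \<open>M \<noteq> {}\<close> \<open>M \<subseteq> T\<close> 1 unfolding is_markers_def by blast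
  next
    case 2
    have "\<exists>B. w -` M = UNIV \<times> B \<and> 1 \<notin> {a - b | a b. a \<in> B \<and> b \<in> B}"
      if w: "w \<in> wang_shift T" for w
    proof (intro exI conjI)
      have "w (a, b) \<in> M \<longleftrightarrow> w (0, b) \<in> M" for a b
        using shift[OF w, of "(_, b)"] 2
        by (intro int_shift_invariant[where P = "\<lambda>a. w (a, b) \<in> M"]) (simp add: unit_vec_def)
      \<comment> \<open>With the axes exchanged, \<open>B\<close> is the trace on the vertical axis,
        by constancy along rows.\<close>
      then show "w -` M = UNIV \<times> {b. w (0, b) \<in> M}"
        by auto
      show "1 \<notin> {a - b | a b. a \<in> {b. w (0, b) \<in> M} \<and> b \<in> {b. w (0, b) \<in> M}}"
        using apart[OF w, of "(0, _)"] 2 by (auto simp: unit_vec_def eq_diff_eq add.commute)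
    qed
    then show ?thesis
      using \<open>M \<noteq> {}\<close> \<open>M \<subseteq> T\<close> 2 unfolding is_markers_def by blast
  qed
qed

end
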